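(* Let $q$ be a prime power, $\alpha\in(1,2)$ and $\varepsilon>0$ be fixed. For each $n$ let $W=W_n$ be the noise distribution of an additive noise channel on $\mathbb{F}_q^n$, let $N\sim W$, and let $1\le k=k_n\le n$ be such that the rate $R=k/n$ satisfies $$R\ \ge\ 1-\frac{H_\alpha(W)}{n}+\varepsilon .$$ Then $$\mathbb{E}_{F\sim\mathcal{B}}\,D_\alpha\big(U_F+N\,\big\|\,U_{\mathbb{F}_q^n}\big)\longrightarrow 0\qquad\text{as } n\to\infty .$$
   Context: Additive noise channel on $\mathbb{F}_q^n$: $W$ is a probability mass function on $\mathbb{F}_q^n$ and the channel outputs $\mathbf{y}$ on input $\mathbf{x}$ with probability $W(\mathbf{y}|\mathbf{x})=W(\mathbf{y}-\mathbf{x})$; $N$ is a random vector with distribution $W$, independent of the channel input. All logarithms are to base $q$. For $\alpha>0$, $\alpha\ne1$: the Rényi entropy is $H_\alpha(W)=\frac{1}{1-\alpha}\log\sum_{\mathbf{x}\in\mathbb{F}_q^n}W(\mathbf{x})^\alpha$, and the Rényi divergence of probability mass functions $P,Q$ on a finite set is $D_\alpha(P\|Q)=\frac{1}{\alpha-1}\log\sum_x P(x)^\alpha Q(x)^{1-\alpha}$ (random variables stand for their distributions). $\mathcal{B}$ is the set of all $[n,k]$ linear codes, i.e. $k$-dimensional subspaces of $\mathbb{F}_q^n$ (each represented by an injective linear encoder $F:\mathbb{F}_q^k\to\mathbb{F}_q^n$ whose image is the code), and $F\sim\mathcal{B}$ means that the code is chosen uniformly at random. $U_F$ is uniform over the codewords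 of $F$ and independent of $N$; $U_{\mathbb{F}_q^n}$ is uniform over $\mathbb{F}_q^n$. *)

theory Defs
  imports "HOL-Probability.Probability" "Jordan_Normal_Form.VS_Connect"
begin

(* The field F_q is a type 'a :: {field, finite}, with q = CARD('a), and F_q^n is
   carrier_vec n.  HOL-Analysis has a type vec and a constant subspace of its own,
   hence the qualified names. *)

definition linear_codes :: "nat \<Rightarrow> nat \<Rightarrow> 'a::field Matrix.vec set set" where
  "linear_codes n k =
     {C. VectorSpace.subspace class_ring C (module_vec TYPE('a) n) \<and>
         vectorspace.dim class_ring ((module_vec TYPE('a) n)\<lparr>carrier := C\<rparr>) = k}"

(* In both definitions b is the base of the logarithm and A is the finite alphabet. *)

definition renyi_entropy :: "real \<Rightarrow> real \<Rightarrow> 'b set \<Rightarrow> 'b pmf \<Rightarrow> real" where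
  "renyi_entropy b \<alpha> A P = 1 / (1 - \<alpha>) * log b (\<Sum>x\<in>A. pmf P x powr \<alpha>)"

(* For \<alpha> > 1 this is the divergence only if Q x > 0 whenever P x > 0 (otherwise the
   divergence is infinite, whereas 0 powr (1 - \<alpha>) = 0).  It is only used below with Q
   uniform on A. *)

definition renyi_divergence :: "real \<Rightarrow> real \<Rightarrow> 'b set \<Rightarrow> 'b pmf \<Rightarrow> 'b pmf \<Rightarrow> real" where
  "renyi_divergence b \<alpha> A P Q =
     1 / (\<alpha> - 1) * log b (\<Sum>x\<in>A. pmf P x powr \<alpha> * pmf Q x powr (1 - \<alpha>))"

(* The distribution of U_C + N, where U_C is uniform on the code C and N, distributed
   according to W, is independent of U_C. *)

definition noisy_codeword :: "'a::field Matrix.vec set \<Rightarrow> 'a Matrix.vec pmf \<Rightarrow> 'a Matrix.vec pmf" where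
  "noisy_codeword C W = map_pmf (\<lambda>(c, z). c + z) (pair_pmf (pmf_of_set C) W)"

end

theory Submission
  imports Defs
begin

text \<open>Write \<open>\<alpha> = 1 + s\<close>, \<open>Q = q\<^sup>n\<close>, \<open>M = q\<^sup>k\<close>. The shift invariance of a code \<open>C\<close> gives
  \<open>Q\<^sup>s \<Sum>\<^sub>y P\<^sub>C(y)\<^sup>\<alpha> = \<Sum>\<^sub>z W(z) (Q/M \<Sum>\<^sub>c W(z + c))\<^sup>s\<close>, where \<open>P\<^sub>C\<close> is the distribution of \<open>U\<^sub>C + N\<close>
  and \<open>c\<close> ranges over \<open>C\<close>. By subadditivity of \<open>t\<^sup>s\<close> the codeword \<open>c = 0\<close> splits off and contributes
  \<open>(Q/M)\<^sup>s \<Sum>\<^sub>z W(z)\<^sup>\<alpha>\<close>, which is at most \<open>q\<close> to the power \<open>-s \<epsilon> n\<close> by the rate condition. For the other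
  codewords \<open>t\<^sup>s \<le> 1 - s + s t\<close> makes the term linear; a random code contains a given nonzero vector
  with probability \<open>(M - 1)/(Q - 1) \<le> M/Q\<close>, because linear bijections act transitively on nonzero
  vectors, so on average these codewords contribute at most 1. Finally \<open>ln x \<le> x - 1\<close> bounds the
  expected divergence, and Bernoulli's inequality shows that it is nonnegative.\<close>

unbundle no vec_syntax \<comment> \<open>\<open>$\<close> is to mean \<open>vec_index\<close> of \<^theory>\<open>Jordan_Normal_Form.Matrix\<close>\<close>

section \<open>Codes as finite sets of vectors\<close>

lemma one_less_card_field: "1 < CARD('a::{field,finite})"
  using card_mono[of UNIV "{0, 1 :: 'a}"] by simp

lemma subspace_vec_iff:
  fixes C :: "'a::field Matrix.vec set"
  shows "VectorSpace.subspace class_ring C (module_vec TYPE('a) n) \<longleftrightarrow>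
    C \<subseteq> carrier_vec n \<and> 0\<^sub>v n \<in> C \<and> (\<forall>x\<in>C. \<forall>y\<in>C. x + y \<in> C) \<and> (\<forall>a. \<forall>x\<in>C. a \<cdot>\<^sub>v x \<in> C)"
proof -
  interpret vec_space "TYPE('a)" n .
  have "Module.module class_ring (module_vec TYPE('a) n)"
    using vec_vs[where 'a='a and n = n] by (simp add: vectorspace_def)
  then show ?thesis
    using vec_vs[where 'a='a and n = n]
    by (auto simp: VectorSpace.subspace_def submodule_def module_vec_simps)
qed

text \<open>Coordinates with respect to a basis \<open>B\<close> identify \<open>C\<close> with the
  functions from \<open>B\<close> to the field.\<close>

lemma card_subspace_vec:
  fixes C :: "'a::{field,finite} Matrix.vec set"
  assumes "VectorSpace.subspace class_ring C (module_vec TYPE('a) n)" and "finite C"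
  shows "card C = CARD('a) ^ vectorspace.dim class_ring ((module_vec TYPE('a) n)\<lparr>carrier := C\<rparr>)"
proof -
  interpret vectorspace class_ring "(module_vec TYPE('a) n)\<lparr>carrier := C\<rparr>"
    using vectorspace.subspace_is_vs[OF vec_vs assms(1)] .
  \<comment> \<open>A finite \<open>C\<close> spans itself, so it is finite-dimensional and has a
    finite basis.\<close>
  have "gen_set C"
    using in_own_span[of C] span_is_subset2[of C] by auto
  then have fin_dim
    unfolding fin_dim_def using assms(2) by auto
  then obtain B where B: "finite B" "basis B"
    using finite_basis_exists by blast
  have BC: "B \<subseteq> C"
    using B by (simp add: basis_def)
  have crit: "\<exists>!a. a \<in> B \<rightarrow>\<^sub>E UNIV \<and> lincomb a B = v" if "v \<in> C" for v
    using basis_criterion[OF B(1)] BC B(2) that by auto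
  have closed: "lincomb a B \<in> C" for a
    using lincomb_closed[of B a] BC by auto
  have "bij_betw (\<lambda>a. lincomb a B) (B \<rightarrow>\<^sub>E UNIV) C"
    unfolding bij_betw_def inj_on_def using crit closed by (auto simp: image_iff) metis+
  then have "card C = card (B \<rightarrow>\<^sub>E (UNIV :: 'a set))"
    by (simp add: bij_betw_same_card)
  then show ?thesis
    using B by (simp add: card_PiE dim_basis)
qed

text \<open>Serves twice: \<open>k = n\<close> counts the whole space, and general \<open>k\<close>
  exhibits a code of dimension \<open>k\<close>, so that the uniform distribution on codes makes
  sense.\<close>

lemma card_vec_supported:
  fixes k n :: nat and S :: "'a::{zero,finite} Matrix.vec set"
  defines "S \<equiv> {x \<in> carrier_vec n. \<forall>i. k \<le> i \<longrightarrow> i < n \<longrightarrow> x $ i = 0}"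
  assumes "k \<le> n"
  shows "finite S" and "card S = CARD('a) ^ k"
proof -
  let ?F = "{..<k} \<rightarrow>\<^sub>E (UNIV :: 'a set)"
  have "bij_betw (\<lambda>f. Matrix.vec n (\<lambda>i. if i < k then f i else 0)) ?F S"
  proof (rule bij_betw_byWitness[where f' = "\<lambda>x. restrict (($) x) {..<k}"])
  qed (use assms in \<open>auto simp: fun_eq_iff PiE_def extensional_def\<close>)
  then show "finite S" "card S = CARD('a) ^ k"
    by (auto simp: bij_betw_finite[symmetric] bij_betw_same_card[symmetric] card_PiE finite_PiE)
qed

lemma carrier_vec_finite:
  shows finite_carrier_vec: "finite (carrier_vec n :: 'a::{zero,finite} Matrix.vec set)"
    and card_carrier_vec: "card (carrier_vec n :: 'a Matrix.vec set) = CARD('a) ^ n"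
  using card_vec_supported[where ?'a = 'a and k = n and n = n] by simp_all

text \<open>Since q > 1, the cardinality q^k determines the dimension \<open>k\<close>. In this
  form, being a code passes to injective linear images without any transport of bases.\<close>

lemma linear_codes_iff:
  fixes C :: "'a::{field,finite} Matrix.vec set"
  shows "C \<in> linear_codes n k \<longleftrightarrow>
    C \<subseteq> carrier_vec n \<and> 0\<^sub>v n \<in> C \<and> (\<forall>x\<in>C. \<forall>y\<in>C. x + y \<in> C) \<and>
    (\<forall>a. \<forall>x\<in>C. a \<cdot>\<^sub>v x \<in> C) \<and> card C = CARD('a) ^ k"
proof -
  have "CARD('a) ^ i = CARD('a) ^ j \<longleftrightarrow> i = j" for i j
    using one_less_card_field[where 'a = 'a] by simp
  then show ?thesis
    using card_subspace_vec[of C n] finite_subset[OF _ finite_carrier_vec[of n], of C]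
    unfolding linear_codes_def subspace_vec_iff by auto
qed

lemma finite_linear_codes: "finite (linear_codes n k :: 'a::{field,finite} Matrix.vec set set)"
  by (rule finite_subset[of _ "Pow (carrier_vec n)"]) (auto simp: linear_codes_iff finite_carrier_vec)

lemma linear_codes_nonempty:
  assumes "k \<le> n"
  shows "linear_codes n k \<noteq> ({} :: 'a::{field,finite} Matrix.vec set set)"
proof -
  have "{x \<in> carrier_vec n. \<forall>i. k \<le> i \<longrightarrow> i < n \<longrightarrow> x $ i = (0 :: 'a)} \<in> linear_codes n k"
    using card_vec_supported[OF assms, where ?'a = 'a] by (auto simp: linear_codes_iff)
  then show ?thesis by blast
qed

section \<open>Transitivity of linear bijections on nonzero vectors\<close>

text \<open>Supplies the functional for the shears below. A unit vector at a nonzero coordinate of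
  \<open>x\<close> or of \<open>y\<close> works unless each vector vanishes at the coordinate chosen
  for the other; then the sum of the two unit vectors works, as no cancellation can occur.\<close>

lemma exists_nonorthogonal:
  fixes x y :: "'a::field Matrix.vec"
  assumes "x \<in> carrier_vec n" "x \<noteq> 0\<^sub>v n" "y \<in> carrier_vec n" "y \<noteq> 0\<^sub>v n"
  obtains v where "v \<in> carrier_vec n" "scalar_prod v x \<noteq> 0" "scalar_prod v y \<noteq> 0"
proof -
  obtain i where i: "i < n" "x $ i \<noteq> 0"
    using assms(1,2) by (metis carrier_vecD eq_vecI index_zero_vec)
  obtain j where j: "j < n" "y $ j \<noteq> 0"
    using assms(3,4) by (metis carrier_vecD eq_vecI index_zero_vec)
  have u: "scalar_prod (unit_vec n l) z = z $ l" if "l < n" "z \<in> carrier_vec n" for l and z :: "'a Matrix.vec"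
    using that by simp
  show ?thesis
  proof (cases "y $ i \<noteq> 0 \<or> x $ j \<noteq> 0")
    case True
    then show ?thesis
      using that[of "unit_vec n i"] that[of "unit_vec n j"] i j assms u by auto
  next
    case False
    then show ?thesis
      using that[of "unit_vec n i + unit_vec n j"] i j assms u
      by (simp add: add_scalar_prod_distrib[where n = n])
  qed
qed

text \<open>The linear map that fixes the hyperplane orthogonal to \<open>v\<close> pointwise and moves \<open>x\<close> to \<open>y\<close>;
  it is a bijection with inverse \<open>shear v y x\<close> if neither \<open>x\<close> nor \<open>y\<close> is orthogonal to \<open>v\<close>.\<close>

definition shear :: "'a::field Matrix.vec \<Rightarrow> 'a Matrix.vec \<Rightarrow> 'a Matrix.vec \<Rightarrow> 'a Matrix.vec \<Rightarrow> 'a Matrix.vec"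
  where "shear v x y z = z + (scalar_prod v z / scalar_prod v x) \<cdot>\<^sub>v (y - x)"

context
  fixes v x y :: "'a::field Matrix.vec" and n :: nat
  assumes carr: "v \<in> carrier_vec n" "x \<in> carrier_vec n" "y \<in> carrier_vec n"
    and nonzero: "scalar_prod v x \<noteq> 0" "scalar_prod v y \<noteq> 0"
begin

lemma shear_carrier: "z \<in> carrier_vec n \<Longrightarrow> shear v x y z \<in> carrier_vec n"
  using carr by (simp add: shear_def)

lemma shear_zero: "shear v x y (0\<^sub>v n) = 0\<^sub>v n"
  using carr by (intro eq_vecI) (auto simp: shear_def)

lemma shear_self: "shear v x y x = y"
  using carr nonzero by (intro eq_vecI) (auto simp: shear_def)

lemma shear_add:
  assumes "z \<in> carrier_vec n" "w \<in> carrier_vec n"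
  shows "shear v x y (z + w) = shear v x y z + shear v x y w"
  using carr assms
  by (intro eq_vecI) (auto simp: shear_def scalar_prod_add_distrib[where n = n] add_divide_distrib algebra_simps)

lemma shear_smult:
  assumes "z \<in> carrier_vec n"
  shows "shear v x y (a \<cdot>\<^sub>v z) = a \<cdot>\<^sub>v shear v x y z"
  using carr assms by (intro eq_vecI) (auto simp: shear_def algebra_simps)

text \<open>\<open>shear v x y\<close> multiplies the product with \<open>v\<close> by the ratio of
  \<open>scalar_prod v y\<close> to \<open>scalar_prod v x\<close>. Both shears therefore use the
  same coefficient, and their corrections along \<open>y - x\<close> and \<open>x - y\<close>
  cancel.\<close>

lemma shear_inverse:
  assumes "z \<in> carrier_vec n"
  shows "shear v y x (shear v x y z) = z"
proof -
  have "scalar_prod v (shear v x y z)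
      = scalar_prod v z + scalar_prod v z / scalar_prod v x * (scalar_prod v y - scalar_prod v x)"
    using carr assms
    by (simp add: shear_def scalar_prod_add_distrib[where n = n] scalar_prod_minus_distrib[where n = n])
  also have "\<dots> / scalar_prod v y = scalar_prod v z / scalar_prod v x"
    using nonzero by (simp add: field_simps)
  finally have "scalar_prod v (shear v x y z) / scalar_prod v y = scalar_prod v z / scalar_prod v x" .
  then have "shear v y x (shear v x y z)
      = shear v x y z + (scalar_prod v z / scalar_prod v x) \<cdot>\<^sub>v (x - y)"
    unfolding shear_def[of v y x] by (simp only:)
  also have "\<dots> = z"
    using carr assms by (intro eq_vecI) (auto simp: shear_def algebra_simps diff_divide_distrib)
  finally show ?thesis .
qed

end

lemma shear_image_code:
  fixes v x y :: "'a::{field,finite} Matrix.vec"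
  assumes "v \<in> carrier_vec n" "x \<in> carrier_vec n" "y \<in> carrier_vec n"
    and "scalar_prod v x \<noteq> 0" "scalar_prod v y \<noteq> 0"
    and C: "C \<in> linear_codes n k"
  shows "shear v x y ` C \<in> linear_codes n k"
proof -
  have "inj_on (shear v x y) (carrier_vec n)"
    by (rule inj_on_inverseI[of _ "shear v y x"]) (rule shear_inverse[OF assms(1-5)])
  then have "inj_on (shear v x y) C"
    using C by (auto simp: linear_codes_iff intro: inj_on_subset)
  then have card: "card (shear v x y ` C) = CARD('a) ^ k"
    using C by (simp add: card_image linear_codes_iff)
  have CV: "c \<in> carrier_vec n" if "c \<in> C" for c
    using C that by (auto simp: linear_codes_iff)
  have zero: "0\<^sub>v n \<in> shear v x y ` C"
    using C shear_zero[OF assms(1-5)] by (metis image_eqI linear_codes_iff)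
  have add: "shear v x y c + shear v x y d \<in> shear v x y ` C" if "c \<in> C" "d \<in> C" for c d
    using that C shear_add[OF assms(1-5) CV CV] by (metis image_eqI linear_codes_iff)
  have smult: "a \<cdot>\<^sub>v shear v x y c \<in> shear v x y ` C" if "c \<in> C" for a c
    using that C shear_smult[OF assms(1-5) CV] by (metis image_eqI linear_codes_iff)
  show ?thesis
    unfolding linear_codes_iff using card zero add smult shear_carrier[OF assms(1-5) CV] by blast
qed

section \<open>Counting the codes through a nonzero vector\<close>

text \<open>Taking images under a shear that moves \<open>x\<close> to \<open>y\<close> is a
  bijection between the two families; the reverse shear undoes it.\<close>

lemma card_codes_through_eq:
  fixes x y :: "'a::{field,finite} Matrix.vec"
  assumes xy: "x \<in> carrier_vec n" "x \<noteq> 0\<^sub>v n" "y \<in> carrier_vec n" "y \<noteq> 0\<^sub>v n"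
  shows "card {C \<in> linear_codes n k. x \<in> C} = card {C \<in> linear_codes n k. y \<in> C}"
proof -
  obtain v where v: "v \<in> carrier_vec n" "scalar_prod v x \<noteq> 0" "scalar_prod v y \<noteq> 0"
    using exists_nonorthogonal[OF xy] .
  have inv: "shear v b a ` shear v a b ` C = C"
    if "C \<in> linear_codes n k" "a \<in> {x, y}" "b \<in> {x, y}" for a b C
    using that v xy shear_inverse[OF v(1), of a b] by (force simp: linear_codes_iff image_image subset_iff)
  have "bij_betw ((`) (shear v x y)) {C \<in> linear_codes n k. x \<in> C} {C \<in> linear_codes n k. y \<in> C}"
  proof (rule bij_betw_byWitness[where f' = "(`) (shear v y x)"])
    show "(`) (shear v x y) ` {C \<in> linear_codes n k. x \<in> C} \<subseteq> {C \<in> linear_codes n k. y \<in> C}"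
      using shear_image_code[OF v(1) xy(1,3) v(2,3)] shear_self[OF v(1) xy(1,3) v(2,3)]
      by (auto simp: image_iff) metis
    show "(`) (shear v y x) ` {C \<in> linear_codes n k. y \<in> C} \<subseteq> {C \<in> linear_codes n k. x \<in> C}"
      using shear_image_code[OF v(1) xy(3,1) v(3,2)] shear_self[OF v(1) xy(3,1) v(3,2)]
      by (auto simp: image_iff) metis
  qed (use inv in auto)
  then show ?thesis
    by (rule bij_betw_same_card)
qed

text \<open>Double counting of the pairs of a code and a nonzero vector in it: by the previous lemma
  every nonzero vector lies in the same number of codes.\<close>

lemma card_codes_through:
  fixes x :: "'a::{field,finite} Matrix.vec"
  assumes x: "x \<in> carrier_vec n" "x \<noteq> 0\<^sub>v n"
  shows "card {C \<in> linear_codes n k. x \<in> C} * (CARD('a) ^ n - 1)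
    = card (linear_codes n k :: 'a Matrix.vec set set) * (CARD('a) ^ k - 1)"
proof -
  let ?L = "linear_codes n k :: 'a Matrix.vec set set"
  let ?V = "carrier_vec n - {0\<^sub>v n} :: 'a Matrix.vec set"
  have "(\<Sum>C\<in>?L. card {z \<in> ?V. z \<in> C}) = card {C \<in> ?L. x \<in> C} * card ?V"
    using card_codes_through_eq[OF _ _ x]
    by (intro sum_multicount) (auto simp: finite_linear_codes finite_carrier_vec)
  moreover have "card {z \<in> ?V. z \<in> C} = CARD('a) ^ k - 1" if "C \<in> ?L" for C
  proof -
    have "{z \<in> ?V. z \<in> C} = C - {0\<^sub>v n}"
      using that by (auto simp: linear_codes_iff)
    then show ?thesis
      using that by (simp add: linear_codes_iff)
  qed
  ultimately show ?thesis
    by (simp add: card_carrier_vec)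
qed

lemma card_codes_through_le:
  fixes x :: "'a::{field,finite} Matrix.vec"
  assumes x: "x \<in> carrier_vec n" "x \<noteq> 0\<^sub>v n" and "k \<le> n"
  shows "real (card {C \<in> linear_codes n k. x \<in> C})
    \<le> real (card (linear_codes n k :: 'a Matrix.vec set set)) * (real CARD('a) ^ k / real CARD('a) ^ n)"
proof -
  define N where "N = real (card {C \<in> linear_codes n k. x \<in> C})"
  define L where "L = real (card (linear_codes n k :: 'a Matrix.vec set set))"
  define Q where "Q = real CARD('a) ^ n"
  define M where "M = real CARD('a) ^ k"
  have M: "1 \<le> M" "M \<le> Q"
    unfolding M_def Q_def using \<open>k \<le> n\<close> by (auto intro: power_increasing)
  \<comment> \<open>Two distinct vectors force \<open>Q\<close> to be at least 2, so the factor
    \<open>Q - 1\<close> can be cancelled at the end.\<close>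
  have "card {0\<^sub>v n, x} \<le> card (carrier_vec n :: 'a Matrix.vec set)"
    using x by (intro card_mono) (auto simp: finite_carrier_vec)
  then have "2 \<le> CARD('a) ^ n"
    using x by (simp add: card_carrier_vec)
  then have Q: "2 \<le> Q"
    unfolding Q_def by (metis of_nat_le_iff of_nat_numeral of_nat_power)
  \<comment> \<open>The subtractions on \<open>nat\<close> are exact because both powers are at
    least 1.\<close>
  have "real (card {C \<in> linear_codes n k. x \<in> C} * (CARD('a) ^ n - 1))
    = real (card (linear_codes n k :: 'a Matrix.vec set set) * (CARD('a) ^ k - 1))"
    by (simp only: card_codes_through[OF x])
  then have eq: "N * (Q - 1) = L * (M - 1)"
    by (simp add: N_def L_def Q_def M_def)
  have "N * Q * (Q - 1) = (N * (Q - 1)) * Q"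
    by simp
  also have "\<dots> = L * (Q * M - Q)"
    unfolding eq by (simp add: algebra_simps)
  also have "\<dots> \<le> L * (Q * M - M)"
    using M by (intro mult_left_mono) (auto simp: L_def)
  also have "\<dots> = L * M * (Q - 1)"
    by (simp add: algebra_simps)
  finally have "N * Q \<le> L * M"
    using Q by simp
  then show ?thesis
    using Q unfolding N_def L_def Q_def M_def by (simp add: field_simps)
qed

text \<open>Exchanging the sums weights each nonzero \<open>x\<close> by the number of codes through
  it. Adding the vector 0 on the right only increases the bound.\<close>

lemma sum_codes_nonzero_le:
  fixes g :: "'a::{field,finite} Matrix.vec \<Rightarrow> real"
  assumes "k \<le> n" and g: "\<And>x. 0 \<le> g x"
  shows "(\<Sum>C\<in>linear_codes n k. \<Sum>x\<in>C - {0\<^sub>v n}. g x)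
    \<le> real (card (linear_codes n k :: 'a Matrix.vec set set)) * (real CARD('a) ^ k / real CARD('a) ^ n)
      * (\<Sum>x\<in>carrier_vec n. g x)"
proof -
  let ?L = "linear_codes n k :: 'a Matrix.vec set set"
  let ?V = "carrier_vec n - {0\<^sub>v n} :: 'a Matrix.vec set"
  let ?r = "real (card ?L) * (real CARD('a) ^ k / real CARD('a) ^ n)"
  have "(\<Sum>C\<in>?L. \<Sum>x\<in>C - {0\<^sub>v n}. g x) = (\<Sum>C\<in>?L. \<Sum>x | x \<in> ?V \<and> x \<in> C. g x)"
    by (intro sum.cong refl arg_cong2[where f = sum]) (auto simp: linear_codes_iff)
  also have "\<dots> = (\<Sum>x\<in>?V. \<Sum>C | C \<in> ?L \<and> x \<in> C. g x)"
    by (rule sum.swap_restrict) (auto simp: finite_linear_codes finite_carrier_vec)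
  also have "\<dots> = (\<Sum>x\<in>?V. real (card {C \<in> ?L. x \<in> C}) * g x)"
    by simp
  also have "\<dots> \<le> (\<Sum>x\<in>?V. ?r * g x)"
    using card_codes_through_le[OF _ _ assms(1)] g by (intro sum_mono mult_right_mono) auto
  also have "\<dots> \<le> (\<Sum>x\<in>carrier_vec n. ?r * g x)"
    using g by (intro sum_mono2) (auto simp: finite_carrier_vec)
  finally show ?thesis
    by (simp add: sum_distrib_left)
qed

section \<open>Inequalities for real powers\<close>

text \<open>The tangent at 1 of a concave power, obtained as Young's inequality with second factor
  1.\<close>

lemma powr_le_linear:
  fixes x s :: real
  assumes "0 \<le> x" "0 \<le> s" "s \<le> 1"
  shows "x powr s \<le> 1 - s + s * x"
  using Youngs_inequality_0[of s "1 - s" x 1] assms by (cases "x = 0") auto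

text \<open>Bernoulli's inequality for real exponents: the tangent bound with exponent
  \<open>1 / a\<close>, applied to \<open>x powr a\<close>.\<close>

lemma powr_ge_linear:
  fixes x a :: real
  assumes "0 \<le> x" "1 \<le> a"
  shows "1 + a * (x - 1) \<le> x powr a"
proof -
  have "(x powr a) powr (1 / a) \<le> 1 - 1 / a + 1 / a * x powr a"
    using assms by (intro powr_le_linear) auto
  then have "a * x \<le> a * (1 - 1 / a + 1 / a * x powr a)"
    using assms by (intro mult_left_mono) (auto simp: powr_powr)
  then show ?thesis
    using assms by (simp add: algebra_simps)
qed

text \<open>After division by \<open>a + b\<close> both terms lie in [0, 1], where t \<le>
  \<open>t powr s\<close>, and they sum to 1.\<close>

lemma powr_subadditive:
  fixes a b s :: real
  assumes "0 \<le> a" "0 \<le> b" "0 \<le> s" "s \<le> 1"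
  shows "(a + b) powr s \<le> a powr s + b powr s"
proof (cases "a + b = 0")
  case False
  then have pos: "0 < a + b" using assms by auto
  have ge: "t / (a + b) \<le> (t / (a + b)) powr s" if "0 \<le> t" "t \<le> a + b" for t
    using that pos assms powr_mono'[of s 1 "t / (a + b)"] by auto
  have "1 = a / (a + b) + b / (a + b)"
    using pos by (simp add: add_divide_distrib[symmetric])
  also have "\<dots> \<le> (a / (a + b)) powr s + (b / (a + b)) powr s"
    using assms by (intro add_mono ge) auto
  also have "\<dots> = (a powr s + b powr s) / (a + b) powr s"
    using assms by (simp add: powr_divide add_divide_distrib)
  finally show ?thesis
    using pos by (simp add: field_simps)
qed (use assms in auto)

section \<open>Divergence from the uniform distribution\<close>

lemma renyi_divergence_uniform:
  assumes "finite A" "A \<noteq> {}"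
  shows "renyi_divergence b \<alpha> A P (pmf_of_set A)
    = 1 / (\<alpha> - 1) * log b (real (card A) powr (\<alpha> - 1) * (\<Sum>x\<in>A. pmf P x powr \<alpha>))"
proof -
  have "(\<Sum>x\<in>A. pmf P x powr \<alpha> * pmf (pmf_of_set A) x powr (1 - \<alpha>))
      = (\<Sum>x\<in>A. pmf P x powr \<alpha> * (1 / real (card A)) powr (1 - \<alpha>))"
    using assms by (intro sum.cong) auto
  also have "(1 / real (card A)) powr (1 - \<alpha>) = real (card A) powr (\<alpha> - 1)"
    using assms by (simp add: powr_divide powr_diff)
  finally show ?thesis
    by (simp add: renyi_divergence_def sum_distrib_left mult.commute)
qed

text \<open>Gives nonnegativity of the divergence. The numbers \<open>?q * pmf P x\<close> average
  to 1 over \<open>A\<close>, so the linear terms cancel when Bernoulli's inequality is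
  summed.\<close>

lemma one_le_renyi_sum:
  fixes \<alpha> :: real
  assumes "finite A" "A \<noteq> {}" "set_pmf P \<subseteq> A" "1 \<le> \<alpha>"
  shows "1 \<le> real (card A) powr (\<alpha> - 1) * (\<Sum>x\<in>A. pmf P x powr \<alpha>)"
proof -
  let ?q = "real (card A)"
  have q: "0 < ?q" using assms by (simp add: card_gt_0_iff)
  have "?q = (\<Sum>x\<in>A. 1 + \<alpha> * (?q * pmf P x - 1))"
    using sum_pmf_eq_1[OF assms(1,3)]
    by (simp add: sum.distrib sum_distrib_left[symmetric] sum_subtractf)
  also have "\<dots> \<le> (\<Sum>x\<in>A. (?q * pmf P x) powr \<alpha>)"
    using assms by (intro sum_mono powr_ge_linear) auto
  also have "\<dots> = ?q * (?q powr (\<alpha> - 1) * (\<Sum>x\<in>A. pmf P x powr \<alpha>))"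
    using q by (simp add: powr_mult powr_diff sum_distrib_left)
  finally show ?thesis
    using q by simp
qed

section \<open>The distribution of a noisy codeword\<close>

lemma set_noisy_codeword:
  assumes "C \<subseteq> carrier_vec n" "finite C" "C \<noteq> {}" "set_pmf W \<subseteq> carrier_vec n"
  shows "set_pmf (noisy_codeword C W) \<subseteq> carrier_vec n"
  using assms by (auto simp: noisy_codeword_def intro!: add_carrier_vec)

lemma pmf_noisy_codeword:
  fixes W :: "'a::field Matrix.vec pmf"
  assumes C: "C \<subseteq> carrier_vec n" "finite C" "C \<noteq> {}"
    and W: "set_pmf W \<subseteq> carrier_vec n" and y: "y \<in> carrier_vec n"
  shows "pmf (noisy_codeword C W) y = (\<Sum>c\<in>C. pmf W (y - c)) / card C"
proof -
  have eq: "noisy_codeword C W = bind_pmf (pmf_of_set C) (\<lambda>c. map_pmf ((+) c) W)"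
    by (simp add: noisy_codeword_def pair_pmf_def map_pmf_def bind_assoc_pmf bind_return_pmf)
  have "pmf (map_pmf ((+) c) W) y = pmf W (y - c)" if "c \<in> C" for c
  proof -
    have c: "c \<in> carrier_vec n" using that C by auto
    have "z = y - c" if "y = c + z" "z \<in> carrier_vec n" for z
      using that c by (intro eq_vecI) auto
    moreover have "c + (y - c) = y"
      using c y by (intro eq_vecI) auto
    ultimately have "(+) c -` {y} \<inter> set_pmf W = {y - c} \<inter> set_pmf W"
      using W by auto
    then have "measure W ((+) c -` {y}) = measure W {y - c}"
      by (metis measure_Int_set_pmf)
    then show ?thesis
      by (simp add: pmf_map measure_pmf_single)
  qed
  then show ?thesis
    using C by (simp add: eq pmf_bind integral_pmf_of_set)
qed

text \<open>Summing over \<open>y = z + c\<close> turns one of the \<open>1 + s\<close> factors into an average over the noise.\<close>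

lemma sum_noisy_powr:
  fixes w :: "'a::{field,finite} Matrix.vec \<Rightarrow> real"
  assumes C: "C \<in> linear_codes n k" and w: "\<And>x. 0 \<le> w x"
  shows "(\<Sum>y\<in>carrier_vec n. (\<Sum>c\<in>C. w (y - c)) powr (1 + s))
    = real (card C) * (\<Sum>z\<in>carrier_vec n. w z * (\<Sum>c\<in>C. w (z + c)) powr s)"
proof -
  let ?V = "carrier_vec n :: 'a Matrix.vec set"
  let ?S = "\<lambda>y. \<Sum>c\<in>C. w (y - c)"
  have CV: "C \<subseteq> ?V"
    using C by (simp add: linear_codes_iff)
  have minus: "c - d \<in> C" if "c \<in> C" "d \<in> C" for c d
  proof -
    have "c - d = c + (-1) \<cdot>\<^sub>v d"
      using that C by (intro eq_vecI) (auto simp: linear_codes_iff)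
    then show ?thesis
      using that C by (auto simp: linear_codes_iff)
  qed
  \<comment> \<open>The involution d to \<open>c - d\<close> of \<open>C\<close> removes the
    dependence on \<open>c\<close>; this is the shift invariance of the code.\<close>
  have shift: "?S (z + c) = (\<Sum>d\<in>C. w (z + d))" if "z \<in> ?V" "c \<in> C" for z c
  proof (rule sum.reindex_bij_witness[of _ "\<lambda>d. c - d" "\<lambda>d. c - d"])
    fix d assume d: "d \<in> C"
    have carr: "z \<in> ?V" "c \<in> ?V" "d \<in> ?V" using that d CV by auto
    then show "c - (c - d) = d" by (intro eq_vecI) auto
    show "c - d \<in> C" using minus that d by auto
    have "z + (c - d) = z + c - d" using carr by (intro eq_vecI) auto
    then show "w (z + (c - d)) = w (z + c - d)" by simp
  qed (use minus that CV in \<open>auto intro!: eq_vecI\<close>)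
  have "(\<Sum>y\<in>?V. ?S y powr (1 + s)) = (\<Sum>y\<in>?V. \<Sum>c\<in>C. w (y - c) * ?S y powr s)"
  proof (rule sum.cong)
    fix y
    \<comment> \<open>The split also holds at 0, where \<open>powr\<close> gives 0.\<close>
    have "?S y powr (1 + s) = ?S y * ?S y powr s"
      using sum_nonneg[of C "\<lambda>c. w (y - c)"] w by (cases "?S y = 0") (auto simp: powr_add)
    then show "?S y powr (1 + s) = (\<Sum>c\<in>C. w (y - c) * ?S y powr s)"
      by (simp add: sum_distrib_right)
  qed simp
  also have "\<dots> = (\<Sum>c\<in>C. \<Sum>y\<in>?V. w (y - c) * ?S y powr s)"
    by (rule sum.swap)
  also have "\<dots> = (\<Sum>c\<in>C. \<Sum>z\<in>?V. w z * (\<Sum>d\<in>C. w (z + d)) powr s)"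
  proof (rule sum.cong)
    fix c assume c: "c \<in> C"
    then have cV: "c \<in> ?V" using CV by auto
    show "(\<Sum>y\<in>?V. w (y - c) * ?S y powr s) = (\<Sum>z\<in>?V. w z * (\<Sum>d\<in>C. w (z + d)) powr s)"
    proof (rule sum.reindex_bij_witness[of _ "\<lambda>z. z + c" "\<lambda>y. y - c"])
      fix y assume y: "y \<in> ?V"
      show *: "y - c + c = y" using y cV by (intro eq_vecI) auto
      show "w (y - c) * (\<Sum>d\<in>C. w (y - c + d)) powr s = w (y - c) * ?S y powr s"
        using shift[of "y - c" c] * y c cV by simp
    qed (use cV in \<open>auto intro!: eq_vecI\<close>)
  qed simp
  finally show ?thesis
    by simp
qed

lemma sum_shift_carrier_vec:
  fixes g :: "'a::{field,finite} Matrix.vec \<Rightarrow> real"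
  assumes z: "z \<in> carrier_vec n"
  shows "(\<Sum>x\<in>carrier_vec n. g (z + x)) = (\<Sum>x\<in>carrier_vec n. g x)"
proof (rule sum.reindex_bij_witness[of _ "\<lambda>x. x - z" "\<lambda>x. z + x"])
  fix x :: "'a Matrix.vec" assume "x \<in> carrier_vec n"
  then show "z + x - z = x" "z + (x - z) = x"
    using z by (auto intro!: eq_vecI)
qed (use z in auto)

section \<open>Power sums of the output: one code, then all codes\<close>

text \<open>The bound for a fixed code is linear in the contribution of its nonzero codewords, so it
  can be summed over all codes afterwards.\<close>

lemma renyi_sum_noisy_codeword_le:
  fixes W :: "'a::{field,finite} Matrix.vec pmf" and n k :: nat
  defines "r \<equiv> real CARD('a) ^ n / real CARD('a) ^ k"
  assumes C: "C \<in> linear_codes n k" and W: "set_pmf W \<subseteq> carrier_vec n" and s: "0 < s" "s \<le> 1"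
  shows "(real CARD('a) ^ n) powr s * (\<Sum>y\<in>carrier_vec n. pmf (noisy_codeword C W) y powr (1 + s))
    \<le> r powr s * (\<Sum>z\<in>carrier_vec n. pmf W z powr (1 + s)) + (1 - s)
      + s * r * (\<Sum>z\<in>carrier_vec n. pmf W z * (\<Sum>c\<in>C - {0\<^sub>v n}. pmf W (z + c)))"
proof -
  let ?V = "carrier_vec n :: 'a Matrix.vec set"
  let ?w = "pmf W"
  let ?T = "\<lambda>z. \<Sum>c\<in>C - {0\<^sub>v n}. ?w (z + c)"
  define Q where "Q = real CARD('a) ^ n"
  define M where "M = real CARD('a) ^ k"
  have pos: "0 < Q" "0 < M" by (auto simp: Q_def M_def)
  have r: "r = Q / M" by (simp add: r_def Q_def M_def)
  have CV: "C \<subseteq> ?V" and zero: "0\<^sub>v n \<in> C" and cardC: "real (card C) = M"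
    using C by (auto simp: linear_codes_iff M_def)
  have finC: "finite C" using CV finite_carrier_vec finite_subset by blast
  have ne: "C \<noteq> {}" using zero by blast
  have "Q powr s * (\<Sum>y\<in>?V. pmf (noisy_codeword C W) y powr (1 + s))
      = Q powr s * (\<Sum>y\<in>?V. ((\<Sum>c\<in>C. ?w (y - c)) / M) powr (1 + s))"
    using pmf_noisy_codeword[OF CV finC ne W] cardC by (intro arg_cong2[where f = "(*)"] sum.cong) auto
  also have "\<dots> = Q powr s / M powr (1 + s) * (\<Sum>y\<in>?V. (\<Sum>c\<in>C. ?w (y - c)) powr (1 + s))"
    using pos by (simp add: powr_divide sum_nonneg sum_divide_distrib[symmetric])
  \<comment> \<open>The factor \<open>card C\<close> from \<open>sum_noisy_powr\<close> cancels one
    of the \<open>1 + s\<close> powers of \<open>M\<close>.\<close>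
  also have "\<dots> = Q powr s / M powr s * (\<Sum>z\<in>?V. ?w z * (\<Sum>c\<in>C. ?w (z + c)) powr s)"
    using pos by (simp only: sum_noisy_powr[where w = "pmf W", OF C pmf_nonneg] cardC) (simp add: powr_add)
  also have "\<dots> = (\<Sum>z\<in>?V. ?w z * (r * (\<Sum>c\<in>C. ?w (z + c))) powr s)"
    unfolding sum_distrib_left[of "Q powr s / M powr s"] r using pos
    by (intro sum.cong refl) (simp add: powr_divide powr_mult sum_nonneg)
  also have "\<dots> \<le> (\<Sum>z\<in>?V. r powr s * ?w z powr (1 + s) + (1 - s) * ?w z + s * r * (?w z * ?T z))"
  proof (rule sum_mono)
    fix z assume z: "z \<in> ?V"
    have split: "(\<Sum>c\<in>C. ?w (z + c)) = ?w z + ?T z"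
      using sum.remove[OF finC zero, of "\<lambda>c. ?w (z + c)"] z by simp
    have T: "0 \<le> ?T z" by (intro sum_nonneg) auto
    have "(r * (\<Sum>c\<in>C. ?w (z + c))) powr s \<le> (r * ?w z) powr s + (r * ?T z) powr s"
      unfolding split distrib_left using pos s T by (intro powr_subadditive) (auto simp: r)
    \<comment> \<open>Only the nonzero codewords are linearized; the zero codeword keeps its power,
      which becomes the entropy term.\<close>
    also have "\<dots> \<le> r powr s * ?w z powr s + (1 - s + s * (r * ?T z))"
      using pos s T by (intro add_mono powr_le_linear) (simp_all add: r powr_mult powr_divide)
    finally have "?w z * (r * (\<Sum>c\<in>C. ?w (z + c))) powr s
        \<le> ?w z * (r powr s * ?w z powr s + (1 - s + s * (r * ?T z)))"
      by (intro mult_left_mono) auto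
    also have "?w z * ?w z powr s = ?w z powr (1 + s)"
      by (cases "?w z = 0") (auto simp: powr_add)
    then have "?w z * (r powr s * ?w z powr s + (1 - s + s * (r * ?T z)))
        = r powr s * ?w z powr (1 + s) + (1 - s) * ?w z + s * r * (?w z * ?T z)"
      by (simp add: algebra_simps)
    finally show "?w z * (r * (\<Sum>c\<in>C. ?w (z + c))) powr s
        \<le> r powr s * ?w z powr (1 + s) + (1 - s) * ?w z + s * r * (?w z * ?T z)" .
  qed
  also have "\<dots> = r powr s * (\<Sum>z\<in>?V. ?w z powr (1 + s)) + (1 - s) + s * r * (\<Sum>z\<in>?V. ?w z * ?T z)"
    using sum_pmf_eq_1[OF finite_carrier_vec W]
    by (simp add: sum.distrib sum_distrib_left[symmetric])
  finally show ?thesis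
    by (simp add: Q_def)
qed

lemma sum_renyi_sum_codes_le:
  fixes W :: "'a::{field,finite} Matrix.vec pmf" and n k :: nat
  defines "r \<equiv> real CARD('a) ^ n / real CARD('a) ^ k"
  assumes "k \<le> n" and W: "set_pmf W \<subseteq> carrier_vec n" and s: "0 < s" "s \<le> 1"
  shows "(\<Sum>C\<in>linear_codes n k.
      (real CARD('a) ^ n) powr s * (\<Sum>y\<in>carrier_vec n. pmf (noisy_codeword C W) y powr (1 + s)))
    \<le> real (card (linear_codes n k :: 'a Matrix.vec set set))
      * (1 + r powr s * (\<Sum>z\<in>carrier_vec n. pmf W z powr (1 + s)))"
proof -
  let ?V = "carrier_vec n :: 'a Matrix.vec set"
  let ?L = "linear_codes n k :: 'a Matrix.vec set set"
  let ?w = "pmf W"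
  let ?E = "r powr s * (\<Sum>z\<in>?V. ?w z powr (1 + s))"
  have r: "0 < r" by (simp add: r_def)
  have sum1: "(\<Sum>z\<in>?V. ?w z) = 1"
    by (rule sum_pmf_eq_1[OF finite_carrier_vec W])
  have "(\<Sum>C\<in>?L. \<Sum>z\<in>?V. ?w z * (\<Sum>c\<in>C - {0\<^sub>v n}. ?w (z + c)))
      = (\<Sum>z\<in>?V. ?w z * (\<Sum>C\<in>?L. \<Sum>c\<in>C - {0\<^sub>v n}. ?w (z + c)))"
    by (subst sum.swap) (simp add: sum_distrib_left)
  also have "\<dots> \<le> (\<Sum>z\<in>?V. ?w z * (real (card ?L) * (1 / r)))"
  proof (intro sum_mono mult_left_mono)
    fix z assume z: "z \<in> ?V"
    \<comment> \<open>Translation by \<open>z\<close> preserves the total noise mass 1, so only the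
      code density \<open>1 / r\<close> remains.\<close>
    have "(\<Sum>C\<in>?L. \<Sum>c\<in>C - {0\<^sub>v n}. ?w (z + c))
        \<le> real (card ?L) * (1 / r) * (\<Sum>c\<in>?V. ?w (z + c))"
      using sum_codes_nonzero_le[OF \<open>k \<le> n\<close>, of "\<lambda>c. ?w (z + c)"] by (simp add: r_def)
    then show "(\<Sum>C\<in>?L. \<Sum>c\<in>C - {0\<^sub>v n}. ?w (z + c)) \<le> real (card ?L) * (1 / r)"
      by (simp add: sum_shift_carrier_vec[OF z] sum1)
  qed simp
  also have "\<dots> = real (card ?L) * (1 / r)"
    by (simp only: sum_distrib_right[symmetric] sum1)
  finally have cross: "(\<Sum>C\<in>?L. \<Sum>z\<in>?V. ?w z * (\<Sum>c\<in>C - {0\<^sub>v n}. ?w (z + c)))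
      \<le> real (card ?L) * (1 / r)" .
  have "(\<Sum>C\<in>?L. (real CARD('a) ^ n) powr s * (\<Sum>y\<in>?V. pmf (noisy_codeword C W) y powr (1 + s)))
      \<le> (\<Sum>C\<in>?L. ?E + (1 - s) + s * r * (\<Sum>z\<in>?V. ?w z * (\<Sum>c\<in>C - {0\<^sub>v n}. ?w (z + c))))"
    unfolding r_def by (intro sum_mono renyi_sum_noisy_codeword_le W s)
  also have "\<dots> = real (card ?L) * (?E + (1 - s))
      + s * r * (\<Sum>C\<in>?L. \<Sum>z\<in>?V. ?w z * (\<Sum>c\<in>C - {0\<^sub>v n}. ?w (z + c)))"
    by (simp add: sum.distrib sum_distrib_left)
  \<comment> \<open>Here \<open>r\<close> cancels and leaves \<open>s\<close>, which completes
    \<open>1 - s\<close> to 1.\<close>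
  also have "\<dots> \<le> real (card ?L) * (?E + (1 - s)) + s * r * (real (card ?L) * (1 / r))"
    using cross r s by (intro add_left_mono mult_left_mono) auto
  also have "\<dots> = real (card ?L) * (1 + ?E)"
    using r by (simp add: algebra_simps)
  finally show ?thesis .
qed

section \<open>The expected divergence and its limit\<close>

lemma expected_renyi_divergence_bounds:
  fixes W :: "'a::{field,finite} Matrix.vec pmf" and n k :: nat and \<alpha> :: real
  defines "E \<equiv> measure_pmf.expectation (pmf_of_set (linear_codes n k))
    (\<lambda>C. renyi_divergence (real CARD('a)) \<alpha> (carrier_vec n)
           (noisy_codeword C W) (pmf_of_set (carrier_vec n)))"
  assumes "k \<le> n" and W: "set_pmf W \<subseteq> carrier_vec n" and \<alpha>: "1 < \<alpha>" "\<alpha> \<le> 2"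
  shows "0 \<le> E"
    and "E \<le> real CARD('a) powr
        ((\<alpha> - 1) * (real n - real k - renyi_entropy (real CARD('a)) \<alpha> (carrier_vec n) W))
      / ((\<alpha> - 1) * ln (real CARD('a)))"
proof -
  let ?V = "carrier_vec n :: 'a Matrix.vec set"
  let ?L = "linear_codes n k :: 'a Matrix.vec set set"
  define q where "q = real CARD('a)"
  define S where "S C = (q ^ n) powr (\<alpha> - 1) * (\<Sum>y\<in>?V. pmf (noisy_codeword C W) y powr \<alpha>)" for C
  define H where "H = renyi_entropy q \<alpha> ?V W"
  define Z where "Z = (\<Sum>z\<in>?V. pmf W z powr \<alpha>)"
  define K where "K = (\<alpha> - 1) * ln q"
  have q: "1 < q"
    using one_less_card_field[where 'a = 'a] by (simp add: q_def)
  have K: "0 < K" using q \<alpha> by (simp add: K_def)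
  have V: "finite ?V" "?V \<noteq> {}" "real (card ?V) = q ^ n"
    using W set_pmf_not_empty[of W] by (auto simp: finite_carrier_vec card_carrier_vec q_def)
  have L: "finite ?L" "?L \<noteq> {}"
    using finite_linear_codes linear_codes_nonempty[OF \<open>k \<le> n\<close>] by auto
  have div: "renyi_divergence q \<alpha> ?V (noisy_codeword C W) (pmf_of_set ?V) = ln (S C) / K" for C
    using renyi_divergence_uniform[OF V(1,2)] by (simp add: S_def V(3) log_def K_def)
  have E: "E = (\<Sum>C\<in>?L. ln (S C) / K) / card ?L"
    unfolding E_def integral_pmf_of_set[OF L(2,1)] q_def[symmetric] div ..
  have S: "1 \<le> S C" if "C \<in> ?L" for C
  proof -
    have "C \<subseteq> ?V" "C \<noteq> {}" "finite C"
      using that V(1) finite_subset by (auto simp: linear_codes_iff)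
    then show ?thesis
      unfolding S_def V(3)[symmetric] using \<alpha> W V(1,2)
      by (intro one_le_renyi_sum set_noisy_codeword) auto
  qed
  show "0 \<le> E"
    unfolding E using S K by (intro divide_nonneg_nonneg sum_nonneg) auto

  \<comment> \<open>Some vector has positive mass, so \<open>Z > 0\<close> and the logarithm in the
    entropy can be inverted.\<close>
  have "set_pmf W \<inter> ?V \<noteq> {}"
    using W set_pmf_not_empty[of W] by blast
  then obtain z where "z \<in> ?V" "0 < pmf W z"
    using pmf_positive by fastforce
  then have Z: "0 < Z"
    unfolding Z_def using V(1) by (intro sum_pos2[of _ z]) auto
  have "log q Z = - (\<alpha> - 1) * H"
    using \<alpha> by (simp add: H_def renyi_entropy_def Z_def field_simps)
  then have Zq: "Z = q powr (- (\<alpha> - 1) * H)"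
    using Z q by (metis less_trans less_numeral_extra(1) less_irrefl powr_log_cancel)
  have "(q ^ n / q ^ k) powr (\<alpha> - 1) = q powr ((\<alpha> - 1) * (real n - real k))"
    using q by (simp add: powr_realpow[symmetric] powr_diff[symmetric] powr_powr mult.commute)
  then have rZ: "(q ^ n / q ^ k) powr (\<alpha> - 1) * Z = q powr ((\<alpha> - 1) * (real n - real k - H))"
    by (simp add: Zq powr_add[symmetric] algebra_simps)

  \<comment> \<open>The subtracted 1 cancels the leading 1 in the averaged bound, so only the
    exponentially small term survives.\<close>
  have "(\<Sum>C\<in>?L. ln (S C)) \<le> (\<Sum>C\<in>?L. S C - 1)"
    using S by (intro sum_mono ln_le_minus_one) fastforce
  also have "\<dots> = (\<Sum>C\<in>?L. S C) - card ?L"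
    by (simp add: sum_subtractf)
  also have "(\<Sum>C\<in>?L. S C) \<le> card ?L * (1 + (q ^ n / q ^ k) powr (\<alpha> - 1) * Z)"
    using sum_renyi_sum_codes_le[OF \<open>k \<le> n\<close> W, of "\<alpha> - 1"] \<alpha> by (simp add: S_def Z_def q_def)
  finally have "(\<Sum>C\<in>?L. ln (S C)) \<le> card ?L * ((q ^ n / q ^ k) powr (\<alpha> - 1) * Z)"
    by (simp add: distrib_left)
  then have "(\<Sum>C\<in>?L. ln (S C)) \<le> card ?L * q powr ((\<alpha> - 1) * (real n - real k - H))"
    unfolding rZ .
  then have "(\<Sum>C\<in>?L. ln (S C)) / card ?L \<le> q powr ((\<alpha> - 1) * (real n - real k - H))"
    using L by (simp add: field_simps card_gt_0_iff)
  then have "(\<Sum>C\<in>?L. ln (S C)) / card ?L / K \<le> q powr ((\<alpha> - 1) * (real n - real k - H)) / K"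
    using K by (intro divide_right_mono) auto
  then have "E \<le> q powr ((\<alpha> - 1) * (real n - real k - H)) / K"
    unfolding E by (simp add: sum_divide_distrib[symmetric] mult.commute)
  then show "E \<le> real CARD('a) powr
        ((\<alpha> - 1) * (real n - real k - renyi_entropy (real CARD('a)) \<alpha> ?V W))
      / ((\<alpha> - 1) * ln (real CARD('a)))"
    by (simp only: q_def K_def H_def)
qed

theorem theorem1:
  fixes \<alpha> \<epsilon> :: real
    and W :: "nat \<Rightarrow> 'a::{field,finite} Matrix.vec pmf"
    and k :: "nat \<Rightarrow> nat"
  assumes "1 < \<alpha>" and "\<alpha> < 2" and "\<epsilon> > 0"
    and "\<And>n. n \<ge> 1 \<Longrightarrow> set_pmf (W n) \<subseteq> carrier_vec n"
    and "\<And>n. n \<ge> 1 \<Longrightarrow> 1 \<le> k n \<and> k n \<le> n"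
    and "\<And>n. n \<ge> 1 \<Longrightarrow>
           real (k n) / real n
             \<ge> 1 - renyi_entropy (real CARD('a)) \<alpha> (carrier_vec n) (W n) / real n + \<epsilon>"
  shows "(\<lambda>n. measure_pmf.expectation (pmf_of_set (linear_codes n (k n)))
            (\<lambda>C. renyi_divergence (real CARD('a)) \<alpha> (carrier_vec n)
                   (noisy_codeword C (W n)) (pmf_of_set (carrier_vec n))))
         \<longlonglongrightarrow> 0"
    (is "?E \<longlonglongrightarrow> 0")
proof (rule tendsto_sandwich)
  define q where "q = real CARD('a)"
  define K where "K = (\<alpha> - 1) * ln q"
  \<comment> \<open>The ratio of the geometric majorant: the rate condition, multiplied by
    \<open>n\<close>, bounds the exponent by
    \<open>(\<alpha> - 1) * - (\<epsilon> * real n)\<close>.\<close>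
  define \<rho> where "\<rho> = q powr (- ((\<alpha> - 1) * \<epsilon>))"
  have q: "1 < q"
    using one_less_card_field[where 'a = 'a] by (simp add: q_def)
  have K: "0 < K" using q assms by (simp add: K_def)
  have "0 < (\<alpha> - 1) * \<epsilon>" using assms by simp
  then have \<rho>: "0 < \<rho>" "\<rho> < 1"
    using q powr_less_mono[of "- ((\<alpha> - 1) * \<epsilon>)" 0 q] by (auto simp: \<rho>_def)
  show "eventually (\<lambda>n. 0 \<le> ?E n) sequentially"
    \<comment> \<open>The hypotheses say nothing about \<open>n = 0\<close>, which the limit
      ignores.\<close>
    using eventually_ge_at_top[of 1]
  proof eventually_elim
    case (elim n)
    then show ?case
      using assms by (intro expected_renyi_divergence_bounds(1)) auto
  qed
  show "eventually (\<lambda>n. ?E n \<le> \<rho> ^ n / K) sequentially"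
    using eventually_ge_at_top[of 1]
  proof eventually_elim
    case (elim n)
    define H where "H = renyi_entropy q \<alpha> (carrier_vec n) (W n)"
    have "real n * (real (k n) / real n) \<ge> real n * (1 - H / real n + \<epsilon>)"
      using assms(6)[OF elim] by (intro mult_left_mono) (auto simp: H_def q_def)
    then have "real n - real (k n) - H \<le> - (\<epsilon> * real n)"
      using elim by (simp add: algebra_simps)
    then have "(\<alpha> - 1) * (real n - real (k n) - H) \<le> (\<alpha> - 1) * - (\<epsilon> * real n)"
      using assms(1) by (intro mult_left_mono) auto
    then have "q powr ((\<alpha> - 1) * (real n - real (k n) - H)) \<le> q powr ((\<alpha> - 1) * - (\<epsilon> * real n))"
      using q by (intro powr_mono) auto
    also have "\<dots> = \<rho> ^ n"
      using \<rho>(1) by (simp add: powr_realpow[symmetric]) (simp add: \<rho>_def powr_powr mult_ac)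
    finally have "q powr ((\<alpha> - 1) * (real n - real (k n) - H)) / K \<le> \<rho> ^ n / K"
      using K by (simp add: divide_right_mono)
    moreover have "?E n \<le> q powr ((\<alpha> - 1) * (real n - real (k n) - H)) / K"
      unfolding q_def K_def H_def
      using assms(1,2) assms(4,5)[OF elim] by (intro expected_renyi_divergence_bounds(2)) auto
    ultimately show ?case by simp
  qed
  have "(\<lambda>n. \<rho> ^ n / K) \<longlonglongrightarrow> 0 / K"
    using \<rho> K by (intro tendsto_divide LIMSEQ_realpow_zero tendsto_const) auto
  then show "(\<lambda>n. \<rho> ^ n / K) \<longlonglongrightarrow> 0"
    by simp
qed simp

end
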